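(* Let $\lambda$ be a nonzero real (or complex) number. For $k\in\mathbb{Z}$ and $n\ge 0$, we have $$\frac{1}{(n+1)^{k}}=\frac{1}{\lambda^{n}(1)_{n+1,1/\lambda}}\sum_{m=0}^{n}(-1)^{m}\beta_{m,\lambda}^{(k)}S_{1,\lambda}(n,m).$$
   Context: For nonzero $\lambda$, the degenerate exponential is $e_\lambda(t)=(1+\lambda t)^{1/\lambda}$, expanded as a power series in $t$. For nonzero $\mu$, put $(1)_{0,\mu}=1$ and $(1)_{n,\mu}=(1-\mu)(1-2\mu)\cdots(1-(n-1)\mu)$ for $n\ge1$ (so $(1)_{1,\mu}=1$). The degenerate logarithm is $\log_{\lambda}(1+t)=\sum_{n=1}^{\infty}\lambda^{n-1}(1)_{n,1/\lambda}\frac{t^{n}}{n!}$. The degenerate Stirling numbers of the first kind $S_{1,\lambda}(n,m)$ are defined, for each $m\ge0$, by $\frac{1}{m!}\big(\log_{\lambda}(1+t)\big)^{m}=\sum_{n=m}^{\infty}S_{1,\lambda}(n,m)\frac{t^{n}}{n!}$. For $k\in\mathbb{Z}$ the degenerate polylogarithm function is $l_{k,\lambda}(x)=\sum_{n=1}^{\infty}\frac{(-\lambda)^{n-1}(1)_{n,1/\lambda}}{(n-1)!\,n^{k}}x^{n}$ $(|x|<1)$, and the degenerate poly-Bernoulli numbers $\beta_{n,\lambda}^{(k)}$ are defined by $$\frac{l_{k,\lambda}(1-e_{\lambda}(-t))}{1-e_{\lambda}(-t)}=\sum_{n=0}^{\infty}\beta_{n,\lambda}^{(k)}\frac{t^{n}}{n!},$$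 i.e. by substituting $x=1-e_\lambda(-t)$ into $l_{k,\lambda}(x)/x$.
   Formalization: The formal theorem additionally assumes $(1)_{n+1,1/\lambda}\neq 0$, i.e. $\lambda\notin\{1,\dots,n\}$; for those $\lambda$ (e.g. $\lambda=1$, $n=1$) the displayed formula divides by zero and is undefined. *)

theory Defs
  imports "HOL-Complex_Analysis.Complex_Analysis"
begin

text \<open>
  All generating functions are formal power series over a field of characteristic 0.
  \<open>degen_one n \<mu>\<close> is \<open>(1)\<^bsub>n,\<mu>\<^esub>\<close>; the product is empty for \<open>n = 0\<close> and \<open>n = 1\<close>.
\<close>

definition degen_one :: "nat \<Rightarrow> 'a::field_char_0 \<Rightarrow> 'a" where
  "degen_one n \<mu> = (\<Prod>i=1..<n. 1 - of_nat i * \<mu>)"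

text \<open>
  \<^term>\<open>fps_binomial c\<close> is the expansion of \<open>(1 + t)\<^sup>c\<close>; substituting \<open>\<lambda>t\<close> for \<open>t\<close> gives
  the expansion of \<open>(1 + \<lambda>t)\<close> to the power \<open>1/\<lambda>\<close>.
\<close>

definition degen_exp :: "'a::field_char_0 \<Rightarrow> 'a fps" where
  "degen_exp lam = fps_compose (fps_binomial (1 / lam)) (fps_const lam * fps_X)"

text \<open>The expansion of \<open>log\<^sub>\<lambda>(1 + t)\<close> in powers of \<open>t\<close>.\<close>

definition degen_log :: "'a::field_char_0 \<Rightarrow> 'a fps" where
  "degen_log lam = Abs_fps (\<lambda>n. if n = 0 then 0
     else lam ^ (n - 1) * degen_one n (1 / lam) / fact n)"

definition degen_stirling1 :: "'a::field_char_0 \<Rightarrow> nat \<Rightarrow> nat \<Rightarrow> 'a" where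
  "degen_stirling1 lam n m = fact n * fps_nth (fps_const (1 / fact m) * degen_log lam ^ m) n"

definition degen_polylog :: "int \<Rightarrow> 'a::field_char_0 \<Rightarrow> 'a fps" where
  "degen_polylog k lam = Abs_fps (\<lambda>n. if n = 0 then 0
     else (- lam) ^ (n - 1) * degen_one n (1 / lam) / (fact (n - 1) * of_nat n powi k))"

definition degen_poly_Bernoulli_gf :: "int \<Rightarrow> 'a::field_char_0 \<Rightarrow> 'a fps" where
  "degen_poly_Bernoulli_gf k lam =
     (let x = 1 - fps_compose (degen_exp lam) (- fps_X)
      in fps_compose (degen_polylog k lam) x / x)"

definition degen_poly_Bernoulli :: "int \<Rightarrow> 'a::field_char_0 \<Rightarrow> nat \<Rightarrow> 'a" where
  "degen_poly_Bernoulli k lam n = fact n * fps_nth (degen_poly_Bernoulli_gf k lam) n"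

lemma has_fps_expansion_degen_exp:
  fixes lam :: complex
  shows "(\<lambda>t. (1 + lam * t) powr (1 / lam)) has_fps_expansion degen_exp lam"
proof -
  have "(\<lambda>t. lam * t) has_fps_expansion fps_const lam * fps_X"
    by (intro fps_expansion_intros)
  from has_fps_expansion_compose[OF has_fps_expansion_binomial_complex this, of "1 / lam"]
  show ?thesis by (simp add: degen_exp_def o_def)
qed

text \<open>
  The quotient defining the generating function is exact: the divisor \<open>1 - e\<^sub>\<lambda>(-t)\<close> is
  nonzero and has zero constant coefficient, and the quotient is the result of substituting
  it into the power series \<open>l\<^bsub>k,\<lambda>\<^esub>(x) / x\<close>.
\<close>

lemma degen_poly_Bernoulli_gf_altdef:
  fixes lam :: "'a::field_char_0"
  assumes "lam \<noteq> 0"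
  defines "x \<equiv> 1 - fps_compose (degen_exp lam) (- fps_X)"
  shows "x \<noteq> 0" and "fps_nth x 0 = 0"
    and "degen_poly_Bernoulli_gf k lam = fps_compose (fps_shift 1 (degen_polylog k lam)) x"
proof -
  have e: "degen_exp lam = Abs_fps (\<lambda>n. lam ^ n * ((1 / lam) gchoose n))"
    by (simp add: degen_exp_def fps_compose_linear fps_eq_iff)
  have X: "(- fps_X :: 'a fps) = fps_const (- 1) * fps_X"
    by (simp flip: fps_const_neg)
  have x: "fps_nth x n = (if n = 0 then 1 else 0) - (- lam) ^ n * ((1 / lam) gchoose n)" for n
    unfolding x_def X by (simp only: fps_compose_linear) (simp add: e power_minus[of lam])
  show x0: "fps_nth x 0 = 0"
    by (simp add: x)
  have "fps_nth x 1 = 1"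
    using assms(1) by (simp add: x)
  then show nz: "x \<noteq> 0"
    by auto
  have "degen_polylog k lam = fps_shift 1 (degen_polylog k lam) * fps_X"
    by (auto simp: fps_eq_iff degen_polylog_def)
  then have "fps_compose (degen_polylog k lam) x =
      fps_compose (fps_shift 1 (degen_polylog k lam)) x * x"
    using x0 by (metis fps_X_fps_compose_startby0 fps_compose_mult_distrib)
  then show "degen_poly_Bernoulli_gf k lam = fps_compose (fps_shift 1 (degen_polylog k lam)) x"
    using nz by (simp add: degen_poly_Bernoulli_gf_def x_def[symmetric])
qed

end

theory Submission
  imports Defs
begin

text \<open>
  The series \<open>log\<^sub>\<lambda>(1 + t) = ((1 + t)\<^sup>\<lambda> - 1) / \<lambda>\<close> satisfies \<open>e\<^sub>\<lambda>(log\<^sub>\<lambda>(1 + t)) = 1 + t\<close>.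
  Hence substituting \<open>t \<mapsto> -log\<^sub>\<lambda>(1 + t)\<close> turns \<open>1 - e\<^sub>\<lambda>(-t)\<close> into \<open>-t\<close>, and the
  generating function of the poly-Bernoulli numbers into \<open>l\<^bsub>k,\<lambda>\<^esub>(-t) / (-t)\<close>. The identity
  compares the coefficients of \<open>t\<^sup>n\<close>.
\<close>

lemma fps_binomial_deriv_mult:
  fixes c :: "'a::field_char_0"
  shows "fps_deriv (fps_binomial c) * (1 + fps_X) = fps_const c * fps_binomial c"
  by (simp add: fps_binomial_deriv fps_divide_unit mult.assoc inverse_mult_eq_1)

text \<open>This is ((1 + t)^d)^c = (1 + t)^(c d) for formal series: the composite solves the
  differential equation (1 + t) F' = c d F with constant term 1, which characterizes
  \<open>fps_binomial (c * d)\<close>.\<close>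

lemma fps_binomial_compose_binomial:
  fixes c d :: "'a::field_char_0"
  shows "fps_compose (fps_binomial c) (fps_binomial d - 1) = fps_binomial (c * d)"
proof -
  define b where "b = fps_binomial d - 1"
  define F where "F = fps_compose (fps_binomial c) b"
  have b0: "fps_nth b 0 = 0"
    by (simp add: b_def)
  have "fps_compose (1 + fps_X) b = fps_binomial d"
    using b0 by (simp add: fps_compose_add_distrib b_def)
  \<comment> \<open>The equation for \<open>fps_binomial c\<close> with \<open>b\<close> substituted
    for t; the factor 1 + t becomes (1 + t)^d.\<close>
  then have outer: "fps_compose (fps_deriv (fps_binomial c)) b * fps_binomial d = fps_const c * F"
    using arg_cong[OF fps_binomial_deriv_mult[of c], of "\<lambda>f. fps_compose f b"]
    by (simp add: fps_compose_mult_distrib[OF b0] F_def)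
  have "fps_deriv F * (1 + fps_X) =
      fps_compose (fps_deriv (fps_binomial c)) b * (fps_deriv (fps_binomial d) * (1 + fps_X))"
    using b0 by (simp add: F_def fps_compose_deriv b_def mult.assoc)
  also have "\<dots> = fps_const d * (fps_const c * F)"
    unfolding fps_binomial_deriv_mult outer[symmetric] by (simp only: mult_ac)
  also have "\<dots> = fps_const (c * d) * F"
    by (simp add: mult_ac flip: fps_const_mult)
  finally have ode: "fps_deriv F * (1 + fps_X) = fps_const (c * d) * F" .
  \<comment> \<open>The uniqueness result wants the equation solved for the derivative, so 1 + t is
    divided out.\<close>
  have unit: "(1 + fps_X :: 'a fps) * inverse (1 + fps_X) = 1"
    by (simp add: inverse_mult_eq_1')
  have "fps_deriv F = fps_deriv F * ((1 + fps_X) * inverse (1 + fps_X))"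
    by (simp add: unit)
  also have "\<dots> = fps_const (c * d) * F / (1 + fps_X)"
    by (simp add: fps_divide_unit flip: ode mult.assoc)
  finally have "F = fps_binomial (c * d)"
    by (subst fps_binomial_ODE_unique'[symmetric]) (simp add: F_def)
  then show ?thesis
    by (simp add: F_def b_def)
qed

lemma degen_log_nth_0 [simp]: "fps_nth (degen_log lam) 0 = 0"
  by (simp add: degen_log_def)

text \<open>Pulling \<open>lam\<close> out of each factor links the numerator of a generalized
  binomial coefficient to the coefficients of \<open>degen_log\<close>.\<close>

lemma prod_diff_of_nat_eq_degen_one:
  fixes lam :: "'a::field_char_0"
  assumes "lam \<noteq> 0"
  shows "(\<Prod>i=0..<Suc m. lam - of_nat i) = lam * (lam ^ m * degen_one (Suc m) (1 / lam))"
proof (induction m)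
  case 0
  show ?case by (simp add: degen_one_def)
next
  case (Suc m)
  have "degen_one (Suc (Suc m)) (1 / lam) = degen_one (Suc m) (1 / lam) * (1 - of_nat (Suc m) / lam)"
    by (simp add: degen_one_def)
  moreover have "lam - of_nat (Suc m) = lam * (1 - of_nat (Suc m) / lam)"
    using assms by (simp add: field_simps)
  ultimately show ?case
    using Suc.IH by (subst prod.atLeast0_lessThan_Suc) (simp only: power_Suc mult_ac)
qed

lemma degen_log_eq_binomial:
  fixes lam :: "'a::field_char_0"
  assumes "lam \<noteq> 0"
  shows "fps_const lam * degen_log lam = fps_binomial lam - 1"
proof (rule fps_ext)
  fix n
  show "fps_nth (fps_const lam * degen_log lam) n = fps_nth (fps_binomial lam - 1) n"
  proof (cases n)
    case (Suc m)
    then show ?thesis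
      using prod_diff_of_nat_eq_degen_one[OF assms, of m]
      by (simp add: degen_log_def gbinomial_prod_rev del: prod.op_ivl_Suc fact_Suc)
  qed simp
qed

text \<open>Since \<open>lam * degen_log lam\<close> is (1 + t)^lam - 1, the exponents
  \<open>1 / lam\<close> and \<open>lam\<close> cancel.\<close>

lemma degen_exp_compose_degen_log:
  fixes lam :: "'a::field_char_0"
  assumes "lam \<noteq> 0"
  shows "fps_compose (degen_exp lam) (degen_log lam) = 1 + fps_X"
proof -
  have "fps_compose (degen_exp lam) (degen_log lam) =
      fps_compose (fps_binomial (1 / lam)) (fps_compose (fps_const lam * fps_X) (degen_log lam))"
    unfolding degen_exp_def by (rule fps_compose_assoc[symmetric]) simp_all
  also have "fps_compose (fps_const lam * fps_X) (degen_log lam) = fps_binomial lam - 1"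
    by (simp add: fps_compose_mult_distrib degen_log_eq_binomial assms)
  finally show ?thesis
    using assms by (simp add: fps_binomial_compose_binomial fps_binomial_1)
qed

lemma degen_poly_Bernoulli_gf_compose_degen_log:
  fixes lam :: "'a::field_char_0"
  assumes "lam \<noteq> 0"
  shows "fps_compose (degen_poly_Bernoulli_gf k lam) (- degen_log lam) =
    fps_compose (fps_shift 1 (degen_polylog k lam)) (- fps_X)"
proof -
  define x where "x = 1 - fps_compose (degen_exp lam) (- fps_X)"
  have x0: "fps_nth x 0 = 0"
    unfolding x_def by (rule degen_poly_Bernoulli_gf_altdef(2)[OF assms])
  \<comment> \<open>The two minus signs cancel, leaving \<open>degen_exp\<close> at
    \<open>degen_log\<close>.\<close>
  have "fps_compose (fps_compose (degen_exp lam) (- fps_X)) (- degen_log lam) =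
      fps_compose (degen_exp lam) (fps_compose (- fps_X) (- degen_log lam))"
    by (rule fps_compose_assoc[symmetric]) simp_all
  then have x_log: "fps_compose x (- degen_log lam) = - fps_X"
    by (simp add: x_def fps_compose_sub_distrib fps_compose_uminus degen_exp_compose_degen_log assms)
  have "fps_compose (degen_poly_Bernoulli_gf k lam) (- degen_log lam) =
      fps_compose (fps_compose (fps_shift 1 (degen_polylog k lam)) x) (- degen_log lam)"
    by (simp add: degen_poly_Bernoulli_gf_altdef(3)[OF assms] x_def)
  also have "\<dots> = fps_compose (fps_shift 1 (degen_polylog k lam)) (fps_compose x (- degen_log lam))"
    by (rule fps_compose_assoc[symmetric]) (simp_all add: x0)
  finally show ?thesis
    by (simp only: x_log)
qed

lemma sum_degen_poly_Bernoulli_degen_stirling1: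
  fixes lam :: "'a::field_char_0"
  assumes "lam \<noteq> 0"
  shows "(\<Sum>m=0..n. (- 1) ^ m * degen_poly_Bernoulli k lam m * degen_stirling1 lam n m) =
    lam ^ n * degen_one (n + 1) (1 / lam) / of_nat (n + 1) powi k"
proof -
  let ?G = "degen_poly_Bernoulli_gf k lam" and ?L = "degen_log lam"
  have pow: "(- ?L) ^ m = fps_const ((- 1) ^ m) * ?L ^ m" for m
    by (subst power_minus) (simp flip: fps_const_power fps_const_neg)
  \<comment> \<open>The factorials of m cancel, and the signs come from the powers of
    \<open>- ?L\<close>.\<close>
  have "(\<Sum>m=0..n. (- 1) ^ m * degen_poly_Bernoulli k lam m * degen_stirling1 lam n m) =
      fact n * fps_nth (fps_compose ?G (- ?L)) n"
    by (simp add: fps_compose_nth sum_distrib_left degen_poly_Bernoulli_def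
        degen_stirling1_def pow mult_ac)
  also have "\<dots> = fact n * fps_nth (fps_compose (fps_shift 1 (degen_polylog k lam)) (- fps_X)) n"
    by (simp only: degen_poly_Bernoulli_gf_compose_degen_log[OF assms])
  \<comment> \<open>The shift selects the polylogarithm coefficient at n + 1, whose denominator
    contains exactly \<open>fact n\<close>.\<close>
  also have "\<dots> = ((- 1) ^ n * (- lam) ^ n) * degen_one (n + 1) (1 / lam) / of_nat (n + 1) powi k"
    by (simp add: fps_compose_uminus' degen_polylog_def)
  also have "(- 1) ^ n * (- lam) ^ n = lam ^ n"
    by (simp flip: power_mult_distrib)
  finally show ?thesis .
qed

text \<open>The second assumption excludes the values 1, ..., n of \<open>lam\<close>, at which the
  denominator vanishes.\<close>

theorem theorem11:
  fixes lam :: "'a::real_normed_field" and k :: int and n :: nat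
  assumes "lam \<noteq> 0"
    and "degen_one (n + 1) (1 / lam) \<noteq> 0"
  shows "1 / (of_nat (n + 1) powi k :: 'a) =
    1 / (lam ^ n * degen_one (n + 1) (1 / lam)) *
      (\<Sum>m=0..n. (- 1) ^ m * degen_poly_Bernoulli k lam m * degen_stirling1 lam n m)"
  using assms by (simp add: sum_degen_poly_Bernoulli_degen_stirling1)

end
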